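(* Let $X$ be a homogeneous Hausdorff topological space. Then $|X|\leq d(X)^{\pi n\chi(X)}$.
   Context: A topological space $X$ is homogeneous if for all $x,y\in X$ there is a homeomorphism $h:X\to X$ with $h(x)=y$. The density $d(X)$ is the least cardinality of a dense subset of $X$. For a subset $N\subseteq X$, a neighborhood base at $N$ is a family $\mathcal{U}$ of open sets, each containing $N$, such that every open set containing $N$ contains some member of $\mathcal{U}$; the character $\chi(N,X)$ is the least cardinality of a neighborhood base at $N$. For a point $x\in X$, a local $\pi$-network at $x$ is a collection $\mathcal{N}$ of nonempty subsets of $X$ (not necessarily open, and not necessarily containing $x$) such that whenever $U$ is open and $x\in U$, there exists $N\in\mathcal{N}$ with $N\subseteq U$. Denote by $\pi n\chi(x,X)$ the least infinite cardinal $\kappa$ such that $x$ has a local $\pi$-network $\mathcal{N}$ with $|\mathcal{N}|\leq\kappa$ and $\chi(N,X)\leq\kappa$ for all $N\in\mathcal{N}$. Define $\pi n\chi(X)=\sup\{\pi n\chi(x,X):x\in X\}$. *)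

theory Defs
  imports "HOL-Analysis.Analysis"
begin

unbundle cardinal_syntax
(* Set_Algebras also uses =o, for set membership *)
no_notation Set_Algebras.elt_set_eq (infix \<open>=o\<close> 50)

definition homogeneous_space :: "'a topology \<Rightarrow> bool" where
  "homogeneous_space X \<longleftrightarrow>
     (\<forall>x\<in>topspace X. \<forall>y\<in>topspace X. \<exists>h. homeomorphic_map X X h \<and> h x = y)"

definition dense_subset :: "'a topology \<Rightarrow> 'a set \<Rightarrow> bool" where
  "dense_subset X D \<longleftrightarrow> D \<subseteq> topspace X \<and> X closure_of D = topspace X"

definition nbhd_base_at_set :: "'a topology \<Rightarrow> 'a set \<Rightarrow> 'a set set \<Rightarrow> bool" where
  "nbhd_base_at_set X N \<U> \<longleftrightarrow>
     (\<forall>U\<in>\<U>. openin X U \<and> N \<subseteq> U) \<and>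
     (\<forall>V. openin X V \<and> N \<subseteq> V \<longrightarrow> (\<exists>U\<in>\<U>. U \<subseteq> V))"

definition local_pi_network :: "'a topology \<Rightarrow> 'a \<Rightarrow> 'a set set \<Rightarrow> bool" where
  "local_pi_network X x \<N> \<longleftrightarrow>
     (\<forall>N\<in>\<N>. N \<noteq> {} \<and> N \<subseteq> topspace X) \<and>
     (\<forall>U. openin X U \<and> x \<in> U \<longrightarrow> (\<exists>N\<in>\<N>. N \<subseteq> U))"

text \<open>
  Cardinals are cardinal orders in the sense of the HOL cardinal library, hence
  determined up to order isomorphism only. The following picks the least cardinal
  with a given (isomorphism-invariant) property among the cardinals that fit into
  the type \<^typ>\<open>'b\<close>. It is only meaningful if such a cardinal exists, so
  at each use \<^typ>\<open>'b\<close> must be large enough; see the lemmas below.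
\<close>

definition least_cardinal :: "('b rel \<Rightarrow> bool) \<Rightarrow> 'b rel" where
  "least_cardinal P =
     (SOME r. Card_order r \<and> P r \<and> (\<forall>r'. Card_order r' \<and> P r' \<longrightarrow> r \<le>o r'))"

definition topological_density :: "'a topology \<Rightarrow> 'a rel" where
  "topological_density X = least_cardinal (\<lambda>r. \<exists>D. dense_subset X D \<and> |D| =o r)"

definition character_at_set :: "'a topology \<Rightarrow> 'a set \<Rightarrow> 'a set rel" where
  "character_at_set X N = least_cardinal (\<lambda>r. \<exists>\<U>. nbhd_base_at_set X N \<U> \<and> |\<U>| =o r)"

definition pi_network_bound :: "'a topology \<Rightarrow> 'a \<Rightarrow> 'c rel \<Rightarrow> bool" where
  "pi_network_bound X x \<kappa> \<longleftrightarrow>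
     cinfinite \<kappa> \<and>
     (\<exists>\<N>. local_pi_network X x \<N> \<and> |\<N>| \<le>o \<kappa> \<and> (\<forall>N\<in>\<N>. character_at_set X N \<le>o \<kappa>))"

text \<open>
  The network consisting of the singleton of \<open>x\<close> shows that some cardinal on the type
  \<^typ>\<open>'a set + nat\<close> is a bound. The summand \<^typ>\<open>nat\<close> is needed because
  \<^typ>\<open>'a\<close> may be finite.
\<close>

definition pi_n_character_at :: "'a topology \<Rightarrow> 'a \<Rightarrow> ('a set + nat) rel" where
  "pi_n_character_at X x = least_cardinal (pi_network_bound X x)"

definition pi_n_character :: "'a topology \<Rightarrow> ('a set + nat) rel" where
  "pi_n_character X =
     least_cardinal (\<lambda>\<kappa>. \<forall>x\<in>topspace X. pi_n_character_at X x \<le>o \<kappa>)"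

text \<open>
  The notions above are well defined: each minimum is attained, and the minima over
  \<^typ>\<open>'a set + nat\<close> are least even among cardinals on arbitrary types.
\<close>

lemma least_cardinal:
  assumes "Card_order r" "P r"
  shows "Card_order (least_cardinal P)" "P (least_cardinal P)"
    and "\<And>r'. Card_order r' \<Longrightarrow> P r' \<Longrightarrow> least_cardinal P \<le>o r'"
proof -
  have "\<exists>r\<in>{r. Card_order r \<and> P r}. \<forall>r'\<in>{r. Card_order r \<and> P r}. r \<le>o r'"
    by (rule exists_minim_Card_order) (use assms in auto)
  then have "\<exists>r. Card_order r \<and> P r \<and> (\<forall>r'. Card_order r' \<and> P r' \<longrightarrow> r \<le>o r')"
    by blast
  from someI_ex[OF this] show "Card_order (least_cardinal P)" "P (least_cardinal P)"
    and "\<And>r'. Card_order r' \<Longrightarrow> P r' \<Longrightarrow> least_cardinal P \<le>o r'"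
    unfolding least_cardinal_def by blast+
qed

lemma Card_order_transfer:
  fixes \<kappa> :: "'c rel"
  assumes "Card_order \<kappa>"
  obtains r :: "'b rel" where "Card_order r" "r =o \<kappa>"
    | "|UNIV :: 'b set| \<le>o \<kappa>"
proof (cases "\<kappa> \<le>o |UNIV :: 'b set|")
  case True
  have "|Field \<kappa>| =o \<kappa>" using assms by (rule card_of_Field_ordIso)
  from this True have "|Field \<kappa>| \<le>o |UNIV :: 'b set|" by (rule ordIso_ordLeq_trans)
  then obtain B :: "'b set" where "|Field \<kappa>| =o |B|"
    using internalize_card_of_ordLeq2[THEN iffD1] by blast
  from ordIso_transitive[OF ordIso_symmetric[OF this] \<open>|Field \<kappa>| =o \<kappa>\<close>]
  show ?thesis by (rule that(1)[OF card_of_Card_order])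
next
  case False
  moreover have "Well_order \<kappa>"
    using assms by (simp add: card_order_on_def)
  ultimately have "|UNIV :: 'b set| \<le>o \<kappa>"
    using ordLeq_total[OF _ card_of_Well_order] by blast
  with that(2) show ?thesis .
qed

lemma Card_order_le_UNIV: "Card_order (r :: 'b rel) \<Longrightarrow> r \<le>o |UNIV :: 'b set|"
  by (rule ordIso_ordLeq_trans[OF ordIso_symmetric[OF card_of_Field_ordIso] card_of_mono1]) auto

lemma topological_density_attained: "\<exists>D. dense_subset X D \<and> |D| =o topological_density X"
  and Card_order_topological_density: "Card_order (topological_density X)"
proof -
  have D: "\<exists>D. dense_subset X D \<and> |D| =o |topspace X|"
    by (rule exI[of _ "topspace X"]) (simp add: dense_subset_def ordIso_refl card_of_Card_order)
  note * = least_cardinal[where P = "\<lambda>r. \<exists>D. dense_subset X D \<and> |D| =o r",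
      OF card_of_Card_order D]
  show "\<exists>D. dense_subset X D \<and> |D| =o topological_density X" "Card_order (topological_density X)"
    unfolding topological_density_def by (fact *)+
qed

lemma topological_density_least:
  assumes "dense_subset X D"
  shows "topological_density X \<le>o |D|"
proof -
  have *: "\<exists>D'. dense_subset X D' \<and> |D'| =o |D|"
    by (intro exI[of _ D] conjI assms ordIso_refl card_of_Card_order)
  show ?thesis
    unfolding topological_density_def by (rule least_cardinal(3)) (fact card_of_Card_order *)+
qed

lemma character_at_set_attained: "\<exists>\<U>. nbhd_base_at_set X N \<U> \<and> |\<U>| =o character_at_set X N"
  and Card_order_character_at_set: "Card_order (character_at_set X N)"
proof -
  have U: "\<exists>\<U>. nbhd_base_at_set X N \<U> \<and> |\<U>| =o |{U. openin X U \<and> N \<subseteq> U}|"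
    by (rule exI[of _ "{U. openin X U \<and> N \<subseteq> U}"])
      (auto simp: nbhd_base_at_set_def ordIso_refl card_of_Card_order)
  note * = least_cardinal[where P = "\<lambda>r. \<exists>\<U>. nbhd_base_at_set X N \<U> \<and> |\<U>| =o r",
      OF card_of_Card_order U]
  show "\<exists>\<U>. nbhd_base_at_set X N \<U> \<and> |\<U>| =o character_at_set X N"
    "Card_order (character_at_set X N)"
    unfolding character_at_set_def by (fact *)+
qed

lemma character_at_set_least:
  assumes "nbhd_base_at_set X N \<U>"
  shows "character_at_set X N \<le>o |\<U>|"
proof -
  have *: "\<exists>\<U>'. nbhd_base_at_set X N \<U>' \<and> |\<U>'| =o |\<U>|"
    by (intro exI[of _ "\<U>"] conjI assms ordIso_refl card_of_Card_order)
  show ?thesis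
    unfolding character_at_set_def by (rule least_cardinal(3)) (fact card_of_Card_order *)+
qed

lemma pi_network_bound_mono:
  assumes "pi_network_bound X x r" "r \<le>o s"
  shows "pi_network_bound X x s"
proof -
  obtain \<N> where \<N>: "local_pi_network X x \<N>" "|\<N>| \<le>o r"
      "\<And>N. N \<in> \<N> \<Longrightarrow> character_at_set X N \<le>o r"
    using assms(1) unfolding pi_network_bound_def by blast
  show ?thesis
    unfolding pi_network_bound_def
  proof (intro conjI exI ballI)
    show "cinfinite s"
      using assms cinfinite_mono unfolding pi_network_bound_def by blast
    show "local_pi_network X x \<N>" by (fact \<N>)
    show "|\<N>| \<le>o s" using \<N>(2) assms(2) by (rule ordLeq_transitive)
    show "character_at_set X N \<le>o s" if "N \<in> \<N>" for N
      using \<N>(3)[OF that] assms(2) by (rule ordLeq_transitive)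
  qed
qed

lemma pi_network_bound_UNIV:
  fixes X :: "'a topology"
  assumes "x \<in> topspace X"
  shows "pi_network_bound X x |UNIV :: ('a set + nat) set|"
proof -
  have inf: "infinite (UNIV :: ('a set + nat) set)"
    by simp
  have "|UNIV :: 'a set set| \<le>o |UNIV :: ('a set + nat) set|"
    by (rule card_of_ordLeqI[of Inl]) auto
  with Card_order_le_UNIV[OF Card_order_character_at_set]
  have "character_at_set X N \<le>o |UNIV :: ('a set + nat) set|" for N
    by (rule ordLeq_transitive)
  moreover have "local_pi_network X x {{x}}"
    using assms by (auto simp: local_pi_network_def)
  moreover have "|{{x}}| \<le>o |UNIV :: ('a set + nat) set|"
    by (rule card_of_ordLeqI[of "\<lambda>_. Inr 0"]) auto
  ultimately show ?thesis
    using inf unfolding pi_network_bound_def cinfinite_def by (auto simp: Field_card_of)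
qed

lemma
  assumes "x \<in> topspace X"
  shows Card_order_pi_n_character_at: "Card_order (pi_n_character_at X x)"
    and pi_n_character_at_attained: "pi_network_bound X x (pi_n_character_at X x)"
proof -
  note * = least_cardinal[where P = "pi_network_bound X x", OF card_of_Card_order
      pi_network_bound_UNIV[OF assms], folded pi_n_character_at_def]
  show "Card_order (pi_n_character_at X x)" "pi_network_bound X x (pi_n_character_at X x)"
    by (fact *)+
qed

lemma pi_n_character_at_least:
  fixes \<kappa> :: "'c rel"
  assumes x: "x \<in> topspace X" and "Card_order \<kappa>" "pi_network_bound X x \<kappa>"
  shows "pi_n_character_at X x \<le>o \<kappa>"
  using \<open>Card_order \<kappa>\<close>
proof (cases rule: Card_order_transfer[where 'b = "'a set + nat"])
  case (1 r)
  have "pi_network_bound X x r"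
    by (rule pi_network_bound_mono[OF assms(3) ordIso_imp_ordLeq[OF ordIso_symmetric[OF 1(2)]]])
  with 1 have "pi_n_character_at X x \<le>o r"
    unfolding pi_n_character_at_def by (intro least_cardinal(3))
  from this 1(2) show ?thesis by (rule ordLeq_ordIso_trans)
next
  case 2
  from Card_order_le_UNIV[OF Card_order_pi_n_character_at[OF x]] this show ?thesis
    by (rule ordLeq_transitive)
qed

lemma
  fixes X :: "'a topology"
  shows Card_order_pi_n_character: "Card_order (pi_n_character X)"
    and pi_n_character_upper: "x \<in> topspace X \<Longrightarrow> pi_n_character_at X x \<le>o pi_n_character X"
proof -
  have "\<forall>x\<in>topspace X. pi_n_character_at X x \<le>o |UNIV :: ('a set + nat) set|"
    by (intro ballI Card_order_le_UNIV) (rule Card_order_pi_n_character_at)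
  note * = least_cardinal[where P = "\<lambda>\<kappa>. \<forall>x\<in>topspace X. pi_n_character_at X x \<le>o \<kappa>",
      OF card_of_Card_order this, folded pi_n_character_def]
  show "Card_order (pi_n_character X)" by (fact *)
  show "x \<in> topspace X \<Longrightarrow> pi_n_character_at X x \<le>o pi_n_character X" using *(2) by blast
qed

lemma pi_n_character_least:
  fixes \<kappa> :: "'c rel" and X :: "'a topology"
  assumes "Card_order \<kappa>" and ub: "\<And>x. x \<in> topspace X \<Longrightarrow> pi_n_character_at X x \<le>o \<kappa>"
  shows "pi_n_character X \<le>o \<kappa>"
  using \<open>Card_order \<kappa>\<close>
proof (cases rule: Card_order_transfer[where 'b = "'a set + nat"])
  case (1 r)
  then have "\<forall>x\<in>topspace X. pi_n_character_at X x \<le>o r"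
    using ordLeq_ordIso_trans[OF ub ordIso_symmetric] by blast
  with 1 have "pi_n_character X \<le>o r"
    unfolding pi_n_character_def by (intro least_cardinal(3))
  from this 1(2) show ?thesis by (rule ordLeq_ordIso_trans)
next
  case 2
  from Card_order_le_UNIV[OF Card_order_pi_n_character] this show ?thesis
    by (rule ordLeq_transitive)
qed

end

theory Submission
  imports Defs
begin

text \<open>
  The neighbourhood bases of the members of a local \<open>\<pi>\<close>-network at \<open>p\<close> together form a local
  \<open>\<pi>\<close>-base \<open>\<B>\<close> at \<open>p\<close> of size at most \<open>\<kappa>\<close>. For each \<open>x\<close> fix a homeomorphism \<open>h\<^sub>x\<close> mapping \<open>p\<close>
  to \<open>x\<close>, and for each \<open>B \<in> \<B>\<close> a point of \<open>h\<^sub>x(B)\<close> in the dense set \<open>D\<close>. The resulting function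
  \<open>\<B> \<rightarrow> D\<close> determines \<open>x\<close>: if \<open>U\<close> and \<open>V\<close> separate \<open>x\<close> and \<open>y\<close>, then some \<open>B \<in> \<B>\<close> satisfies
  \<open>h\<^sub>x(B) \<subseteq> U\<close> and \<open>h\<^sub>y(B) \<subseteq> V\<close>.
\<close>

definition local_pi_base :: "'a topology \<Rightarrow> 'a \<Rightarrow> 'a set set \<Rightarrow> bool" where
  "local_pi_base X x \<B> \<longleftrightarrow> local_pi_network X x \<B> \<and> (\<forall>B\<in>\<B>. openin X B)"

text \<open>Network members may fail to be open, so their images could miss a dense set; open
  neighbourhoods cannot. Passing to these costs at most \<kappa> many families of size at most
  \<kappa>, which an infinite \<kappa> absorbs.\<close>

lemma local_pi_base_of_network:
  assumes "Card_order \<kappa>" "pi_network_bound X x \<kappa>"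
  obtains \<B> where "local_pi_base X x \<B>" "|\<B>| \<le>o \<kappa>"
proof -
  obtain \<N> where \<kappa>: "cinfinite \<kappa>" and net: "local_pi_network X x \<N>" and card: "|\<N>| \<le>o \<kappa>"
    and char: "\<And>N. N \<in> \<N> \<Longrightarrow> character_at_set X N \<le>o \<kappa>"
    using assms(2) unfolding pi_network_bound_def by blast
  obtain \<U> where base: "\<And>N. nbhd_base_at_set X N (\<U> N)"
    and card_base: "\<And>N. |\<U> N| =o character_at_set X N"
    using character_at_set_attained[of X] by metis
  show thesis
  proof
    show "local_pi_base X x (\<Union>N\<in>\<N>. \<U> N)"
      unfolding local_pi_base_def local_pi_network_def
    proof (intro conjI ballI allI impI)
      fix B assume "B \<in> (\<Union>N\<in>\<N>. \<U> N)"
      then obtain N where "N \<in> \<N>" "B \<in> \<U> N" by blast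
      moreover from this have "N \<noteq> {}" "openin X B" "N \<subseteq> B"
        using net base[of N] by (auto simp: local_pi_network_def nbhd_base_at_set_def)
      ultimately show "B \<noteq> {}" "openin X B" "B \<subseteq> topspace X"
        by (auto dest: openin_subset)
    next
      fix U assume U: "openin X U \<and> x \<in> U"
      then obtain N where N: "N \<in> \<N>" "N \<subseteq> U"
        using net by (auto simp: local_pi_network_def)
      then obtain B where "B \<in> \<U> N" "B \<subseteq> U"
        using base[of N] U by (auto simp: nbhd_base_at_set_def)
      with N show "\<exists>B\<in>\<Union>N\<in>\<N>. \<U> N. B \<subseteq> U" by blast
    qed
    show "|\<Union>N\<in>\<N>. \<U> N| \<le>o \<kappa>"
    proof (rule card_of_UNION_ordLeq_infinite_Field)
      show "infinite (Field \<kappa>)" using \<kappa> by (simp add: cinfinite_def)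
      show "\<forall>N\<in>\<N>. |\<U> N| \<le>o \<kappa>" using ordIso_ordLeq_trans[OF card_base char] by blast
    qed (fact assms(1) card)+
  qed
qed

text \<open>Homogeneity lets the single family \<B> at \<open>p\<close> index the codes of all
  points, so that they lie in one function space.\<close>

lemma card_of_homogeneous_Hausdorff:
  assumes "Hausdorff_space X" "homogeneous_space X" "dense_subset X D"
    and p: "p \<in> topspace X" and base: "local_pi_base X p \<B>"
  shows "|topspace X| \<le>o |Func \<B> D|"
proof -
  obtain h where homeo: "\<And>x. x \<in> topspace X \<Longrightarrow> homeomorphic_map X X (h x)"
    and hp: "\<And>x. x \<in> topspace X \<Longrightarrow> h x p = x"
    using assms(2) p unfolding homogeneous_space_def by metis
  have "\<exists>d. d \<in> h x ` B \<inter> D" if x: "x \<in> topspace X" and B: "B \<in> \<B>" for x B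
  proof -
    have "openin X B" "B \<noteq> {}"
      using B base by (auto simp: local_pi_base_def local_pi_network_def)
    with homeomorphic_imp_open_map[OF homeo[OF x]]
    have "openin X (h x ` B)" "h x ` B \<noteq> {}"
      by (auto simp: open_map_def)
    moreover from this openin_subset have "h x ` B \<inter> X closure_of D \<noteq> {}"
      using assms(3) unfolding dense_subset_def by blast
    ultimately show ?thesis
      using openin_Int_closure_of_eq_empty by blast
  qed
  then obtain d where d: "\<And>x B. x \<in> topspace X \<Longrightarrow> B \<in> \<B> \<Longrightarrow> d x B \<in> h x ` B \<inter> D"
    by metis
  \<comment> \<open>\<open>Func\<close> contains only functions that are \<open>undefined\<close>
    off their domain.\<close>
  define F where "F x B = (if B \<in> \<B> then d x B else undefined)" for x B
  have "inj_on F (topspace X)"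
  proof (rule inj_onI, rule ccontr)
    fix x y assume x: "x \<in> topspace X" and y: "y \<in> topspace X" and F: "F x = F y" and "x \<noteq> y"
    then obtain U V where U: "openin X U" "x \<in> U" and V: "openin X V" "y \<in> V"
      and disj: "disjnt U V"
      using assms(1) unfolding Hausdorff_space_def by blast
    \<comment> \<open>Pulling both neighbourhoods back to \<open>p\<close> yields one
      \<open>B\<close> that works for \<open>h x\<close> and \<open>h y\<close>
      simultaneously.\<close>
    define W where "W = {z \<in> topspace X. h x z \<in> U} \<inter> {z \<in> topspace X. h y z \<in> V}"
    have "openin X W"
      unfolding W_def using U V homeo[OF x] homeo[OF y]
      by (intro openin_Int openin_continuous_map_preimage[OF homeomorphic_imp_continuous_map])
    moreover have "p \<in> W"
      using U V p hp x y by (simp add: W_def)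
    ultimately obtain B where B: "B \<in> \<B>" "B \<subseteq> W"
      using base by (auto simp: local_pi_base_def local_pi_network_def)
    then have "d x B \<in> U" "d y B \<in> V"
      using d[OF x B(1)] d[OF y B(1)] by (auto simp: W_def)
    moreover have "d x B = d y B"
      using fun_cong[OF F, of B] B by (simp add: F_def)
    ultimately show False
      using disj by (auto simp: disjnt_def)
  qed
  moreover have "F ` topspace X \<subseteq> Func \<B> D"
    using d by (auto simp: F_def Func_def)
  ultimately show ?thesis
    using card_of_ordLeq[of "topspace X" "Func \<B> D"] by blast
qed

theorem theorem3p4:
  fixes X :: "'a topology"
  assumes "Hausdorff_space X" and "homogeneous_space X"
  shows "|topspace X| \<le>o topological_density X ^c pi_n_character X"
proof (cases "topspace X = {}")
  case True
  then show ?thesis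
    unfolding cexp_def by (simp add: card_of_empty)
next
  case False
  then obtain p where p: "p \<in> topspace X" by blast
  have "pi_network_bound X p (pi_n_character X)"
    using pi_n_character_at_attained[OF p] pi_n_character_upper[OF p]
    by (rule pi_network_bound_mono)
  then obtain \<B> where \<B>: "local_pi_base X p \<B>" "|\<B>| \<le>o pi_n_character X"
    by (rule local_pi_base_of_network[OF Card_order_pi_n_character])
  obtain D where D: "dense_subset X D" "|D| =o topological_density X"
    using topological_density_attained by blast
  \<comment> \<open>Needed for monotonicity in the exponent, which can fail at exponent zero: 0^0 =
    1, but 0^\<kappa> = 0 for nonzero \<kappa>. The whole space is a neighbourhood of
    \<open>p\<close>, so it contains some member of \<B>.\<close>
  have "\<B> \<noteq> {}"
    using \<B>(1) p by (auto simp: local_pi_base_def local_pi_network_def)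
  have "|topspace X| \<le>o |D| ^c |\<B>|"
    using card_of_homogeneous_Hausdorff[OF assms D(1) p \<B>(1)]
    unfolding cexp_def Field_card_of .
  also have "|D| ^c |\<B>| \<le>o topological_density X ^c pi_n_character X"
  proof (rule cexp_mono[OF ordIso_imp_ordLeq[OF D(2)] \<B>(2) _ card_of_Card_order])
    assume "|\<B>| =o (czero :: ('a set + nat) rel)"
    with \<open>\<B> \<noteq> {}\<close> show "pi_n_character X =o (czero :: ('a set + nat) rel)"
      by (simp only: card_of_ordIso_czero_iff_empty)
  qed
  finally show ?thesis .
qed

end
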